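(* Let $p\in(0,1)$, $\nu>0$, let $d:[0,1]\to\mathbb{R}$ be strongly convex and $D(q)=\sum_{i=1}^n d(q_i)$. The infimal convolution smoothing of the superquantile $\mathbb{S}_p$ with $D$, $$\mathbb{S}_p^\nu(u)=\max_{q\in\Delta_p}\{q^\top u-\nu D(q)\},\qquad \Delta_p=\Big\{q\in\mathbb{R}^n_+:\ \sum_{i=1}^n q_i=1,\ q_i\le\tfrac1{n(1-p)}\Big\},$$ is equivalent to the infimal convolution smoothing of the positive part $\max\{\cdot,0\}$ given by $$m_\nu(\eta)=\max_{0\le t\le1}\{\eta\,t-\nu\,\tilde d(t)\}\quad\text{with}\quad \tilde d(t)=n(1-p)\,d\Big(\frac{t}{n(1-p)}\Big).$$ More precisely, for every $u=(u_1,\ldots,u_n)\in\mathbb{R}^n$, $$\mathbb{S}_p^\nu(u)=\min_{\eta\in\mathbb{R}}\Big\{\eta+\frac1{n(1-p)}\sum_{i=1}^n m_\nu(u_i-\eta)\Big\}.$$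
   Context: The superquantile of a vector $u\in\mathbb{R}^n$ of equiprobable values is $\mathbb{S}_p(u)=\max_{q\in\Delta_p}q^\top u=\inf_{\eta\in\mathbb{R}}\{\eta+\frac1{n(1-p)}\sum_{i=1}^n\max(u_i-\eta,0)\}$. The maxima above are understood as attained, and the segment $[0,\frac1{n(1-p)}]$ is understood to lie in the domain $[0,1]$ of $d$, so that $\tilde d$ is defined on $[0,1]$. "Equivalent" means precisely the displayed equality. *)

theory Defs
  imports "HOL-Analysis.Analysis"
begin

definition strongly_convex_on :: "'a::real_inner set \<Rightarrow> ('a \<Rightarrow> real) \<Rightarrow> bool" where
  "strongly_convex_on S f \<longleftrightarrow> convex S \<and>
     (\<exists>c>0. \<forall>x\<in>S. \<forall>y\<in>S. \<forall>t\<in>{0..1}.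
        f (t *\<^sub>R x + (1 - t) *\<^sub>R y)
          \<le> t * f x + (1 - t) * f y - c / 2 * t * (1 - t) * (norm (x - y))\<^sup>2)"

text \<open>Vectors of size $n$ are elements of \<^typ>\<open>real ^ 'n\<close>, with $n$ the cardinality of the index
  type. A maximum is written as a supremum; since the supremum of an arbitrary set of reals
  carries no information about attainment (and is unspecified for unbounded sets), it is to be
  read together with the existence of a maximiser.\<close>

definition risk_envelope :: "real \<Rightarrow> (real ^ 'n) set" where
  "risk_envelope p =
     {q. (\<forall>i. 0 \<le> q $ i) \<and> (\<Sum>i\<in>UNIV. q $ i) = 1 \<and>
         (\<forall>i. q $ i \<le> 1 / (real CARD('n) * (1 - p)))}"

definition separable :: "(real \<Rightarrow> real) \<Rightarrow> real ^ 'n \<Rightarrow> real" where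
  "separable d q = (\<Sum>i\<in>UNIV. d (q $ i))"

definition superquantile_objective ::
    "real \<Rightarrow> (real \<Rightarrow> real) \<Rightarrow> real ^ 'n \<Rightarrow> real ^ 'n \<Rightarrow> real" where
  "superquantile_objective \<nu> d u q = q \<bullet> u - \<nu> * separable d q"

definition smoothed_superquantile ::
    "real \<Rightarrow> real \<Rightarrow> (real \<Rightarrow> real) \<Rightarrow> real ^ 'n \<Rightarrow> real" where
  "smoothed_superquantile p \<nu> d u = (SUP q\<in>risk_envelope p. superquantile_objective \<nu> d u q)"

definition rescaled :: "nat \<Rightarrow> real \<Rightarrow> (real \<Rightarrow> real) \<Rightarrow> real \<Rightarrow> real" where
  "rescaled n p d t = real n * (1 - p) * d (t / (real n * (1 - p)))"

definition pos_part_objective :: "real \<Rightarrow> (real \<Rightarrow> real) \<Rightarrow> real \<Rightarrow> real \<Rightarrow> real" where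
  "pos_part_objective \<nu> e \<eta> t = \<eta> * t - \<nu> * e t"

definition smoothed_pos_part :: "real \<Rightarrow> (real \<Rightarrow> real) \<Rightarrow> real \<Rightarrow> real" where
  "smoothed_pos_part \<nu> e \<eta> = (SUP t\<in>{0..1}. pos_part_objective \<nu> e \<eta> t)"

end

theory Submission
  imports Defs
begin

text \<open>
  The formula is Lagrangian duality for the single constraint \<open>\<Sum>\<^sub>i q\<^sub>i = 1\<close>. Write
  \<open>N = n (1 - p)\<close>. Relaxing that constraint with a multiplier \<open>\<eta>\<close> leaves the box
  \<open>0 \<le> q\<^sub>i \<le> 1 / N\<close>, on which the Lagrangian
  \<open>\<Sum>\<^sub>i (q\<^sub>i u\<^sub>i - \<nu> d (q\<^sub>i)) - \<eta> (\<Sum>\<^sub>i q\<^sub>i - 1)\<close> is, up to the constant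
  \<open>\<eta>\<close>, a sum of functions of one coordinate each.
  The substitution \<open>t\<^sub>i = N q\<^sub>i\<close> turns each summand into \<open>1 / N\<close> times the objective that defines
  \<open>m\<^sub>\<nu> (u\<^sub>i - \<eta>)\<close> (lemma \<open>superquantile_objective_lagrangian\<close>), so the right-hand side of the
  formula is the dual function at \<open>\<eta>\<close>.

  Weak duality bounds the dual function from below by the smoothed superquantile. Equality at some
  \<open>\<eta>\<close> is the existence of a multiplier (lemma \<open>concave_lagrange_multiplier\<close>): the objective is
  concave on the box, and since \<open>0 < p < 1\<close> the value \<open>1\<close> lies strictly between the smallest
  coordinate sum \<open>0\<close> and the largest one \<open>1 / (1 - p)\<close>, so the constraint can be violated in both
  directions. At such an \<open>\<eta>\<close> the dual function attains its minimum, by weak duality.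
\<close>

text \<open>
  When \<open>x\<close> is a maximiser on \<open>C \<inter> {L = b}\<close>, the multiplier is a supergradient at \<open>b\<close> of the concave value function
  \<open>s \<mapsto> sup {f y | y \<in> C, L y = s}\<close>. It is found here as a supremum of slopes: a slope from \<open>x\<close> to a
  point \<open>y\<close> with \<open>L y > b\<close> never exceeds a slope from a point \<open>z\<close> with \<open>L z < b\<close> to \<open>x\<close>, because
  the segment from \<open>z\<close> to \<open>y\<close> meets the hyperplane \<open>L = b\<close>, where \<open>f\<close> is at most \<open>f x\<close>. The
  point \<open>y0\<close> makes the set of slopes nonempty and \<open>z0\<close> bounds it.
\<close>

lemma concave_lagrange_multiplier:
  fixes f L :: "'a::real_vector \<Rightarrow> real"
  assumes conc: "concave_on C f" and lin: "linear L"
    and max: "\<And>y. y \<in> C \<Longrightarrow> L y = b \<Longrightarrow> f y \<le> f x"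
    and below: "z0 \<in> C" "L z0 < b" and above: "y0 \<in> C" "b < L y0"
  obtains \<eta> where "\<And>y. y \<in> C \<Longrightarrow> f y \<le> f x + \<eta> * (L y - b)"
proof -
  have slopes: "(f y - f x) / (L y - b) \<le> (f x - f z) / (b - L z)"
    if y: "y \<in> C" "b < L y" and z: "z \<in> C" "L z < b" for y z
  proof -
    \<comment> \<open>The weights put \<open>l *\<^sub>R y + m *\<^sub>R z\<close> on the hyperplane \<open>L = b\<close>.\<close>
    define l where "l = (b - L z) / (L y - L z)"
    define m where "m = (L y - b) / (L y - L z)"
    have pos: "L y - L z > 0" using y z by simp
    have lm: "l \<ge> 0" "m \<ge> 0" using y z by (simp_all add: l_def m_def)
    have sum1: "l + m = 1" using pos by (simp add: l_def m_def flip: add_divide_distrib)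
    let ?w = "l *\<^sub>R y + m *\<^sub>R z"
    have "?w \<in> C"
      using conc y z lm sum1 by (auto simp: concave_on_iff convex_def)
    moreover have "L ?w = b"
    proof -
      have "L ?w = l * L y + m * L z"
        by (simp add: linear_add[OF lin] linear_scale[OF lin])
      also have "\<dots> = ((b - L z) * L y + (L y - b) * L z) / (L y - L z)"
        by (simp add: l_def m_def add_divide_distrib)
      also have "(b - L z) * L y + (L y - b) * L z = b * (L y - L z)"
        by (simp add: algebra_simps)
      also have "b * (L y - L z) / (L y - L z) = b" using pos by simp
      finally show ?thesis .
    qed
    ultimately have "f ?w \<le> f x" by (rule max)
    moreover have "l * f y + m * f z \<le> f ?w"
      using conc y z lm sum1 by (auto simp: concave_on_iff)
    ultimately have "l * f y + m * f z \<le> f x" by simp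
    then have "((b - L z) * f y + (L y - b) * f z) / (L y - L z) \<le> f x"
      by (simp add: l_def m_def add_divide_distrib)
    then have "(b - L z) * f y + (L y - b) * f z \<le> f x * (L y - L z)"
      using pos by (simp add: pos_divide_le_eq)
    then have "(f y - f x) * (b - L z) \<le> (f x - f z) * (L y - b)"
      by (simp add: algebra_simps)
    then show ?thesis using y z by (simp add: pos_divide_le_eq pos_le_divide_eq)
  qed
  define R where "R = (\<lambda>y. (f y - f x) / (L y - b)) ` {y \<in> C. b < L y}"
  have R_le: "r \<le> (f x - f z) / (b - L z)" if "r \<in> R" "z \<in> C" "L z < b" for r z
    using that slopes by (auto simp: R_def)
  have bdd: "bdd_above R" using R_le[OF _ below] by (auto simp: bdd_above_def)
  have ne: "R \<noteq> {}" using above by (auto simp: R_def)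
  show thesis
  proof
    fix y assume y: "y \<in> C"
    consider "L y = b" | "L y > b" | "L y < b" by linarith
    then show "f y \<le> f x + Sup R * (L y - b)"
    proof cases
      case 1
      then show ?thesis using max[OF y] by simp
    next
      case 2
      have "(f y - f x) / (L y - b) \<le> Sup R"
        using y 2 bdd by (intro cSup_upper) (auto simp: R_def)
      then show ?thesis using 2 by (simp add: pos_divide_le_eq)
    next
      case 3
      have "Sup R \<le> (f x - f y) / (b - L y)"
        using ne R_le y 3 by (intro cSup_least) auto
      then have "Sup R * (b - L y) \<le> f x - f y"
        using 3 by (simp add: pos_le_divide_eq)
      then show ?thesis by (simp add: algebra_simps)
    qed
  qed
qed

lemma strongly_convex_on_imp_convex_on:
  assumes "strongly_convex_on S f"
  shows "convex_on S f"
proof -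
  obtain c where c: "c > 0" and ineq: "\<And>x y t. x \<in> S \<Longrightarrow> y \<in> S \<Longrightarrow> t \<in> {0..1} \<Longrightarrow>
      f (t *\<^sub>R x + (1 - t) *\<^sub>R y)
        \<le> t * f x + (1 - t) * f y - c / 2 * t * (1 - t) * (norm (x - y))\<^sup>2"
    using assms by (auto simp: strongly_convex_on_def)
  have "f (s *\<^sub>R x + t *\<^sub>R y) \<le> s * f x + t * f y"
    if "x \<in> S" "y \<in> S" "0 \<le> s" "0 \<le> t" "s + t = 1" for x y s t
  proof -
    have t: "t = 1 - s" using that by simp
    have "0 \<le> c / 2 * s * (1 - s) * (norm (x - y))\<^sup>2"
      using c that t by (intro mult_nonneg_nonneg) auto
    then show ?thesis using ineq[of x y s] that unfolding t by auto
  qed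
  then show ?thesis
    using assms by (auto simp: convex_on_def strongly_convex_on_def)
qed

lemma concave_on_superquantile_objective:
  fixes u :: "real ^ 'n"
  assumes conv: "convex_on I d" and "0 \<le> \<nu>"
  shows "concave_on {q. \<forall>i. q $ i \<in> I} (superquantile_objective \<nu> d u)"
proof -
  have "convex I" using conv by (simp add: convex_on_def)
  then have "convex {q :: real ^ 'n. \<forall>i. q $ i \<in> I}"
    by (auto simp: convex_def)
  moreover have "s * superquantile_objective \<nu> d u x + t * superquantile_objective \<nu> d u y
      \<le> superquantile_objective \<nu> d u (s *\<^sub>R x + t *\<^sub>R y)"
    if "\<forall>i. x $ i \<in> I" "\<forall>i. y $ i \<in> I" "0 \<le> s" "0 \<le> t" "s + t = 1" for x y s t
  proof -
    have "separable d (s *\<^sub>R x + t *\<^sub>R y) \<le> (\<Sum>i\<in>UNIV. s * d (x $ i) + t * d (y $ i))"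
      using conv that by (auto simp: separable_def convex_on_def intro!: sum_mono)
    also have "\<dots> = s * separable d x + t * separable d y"
      by (simp add: separable_def sum.distrib sum_distrib_left)
    finally have "\<nu> * separable d (s *\<^sub>R x + t *\<^sub>R y)
        \<le> \<nu> * (s * separable d x + t * separable d y)"
      using \<open>0 \<le> \<nu>\<close> by (rule mult_left_mono)
    then show ?thesis
      by (simp add: superquantile_objective_def inner_add_left algebra_simps)
  qed
  ultimately show ?thesis by (auto simp: concave_on_iff)
qed

lemma SUP_eq_is_arg_max:
  fixes f :: "'a \<Rightarrow> 'b::conditionally_complete_linorder"
  assumes "is_arg_max f (\<lambda>x. x \<in> S) x"
  shows "(SUP y\<in>S. f y) = f x"
  using assms by (intro cSup_eq_maximum) (auto simp: is_arg_max_linorder)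

text \<open>
  The left-hand side is the Lagrangian of the constraint \<open>\<Sum>\<^sub>i q\<^sub>i = 1\<close>. The scaling of \<open>d\<close> inside
  \<open>rescaled\<close> is exactly the one for which \<open>t\<^sub>i = n (1 - p) q\<^sub>i\<close> carries the terms \<open>d (q\<^sub>i)\<close> over.
\<close>

lemma superquantile_objective_lagrangian:
  fixes u q :: "real ^ 'n"
  assumes "p < 1"
  defines "N \<equiv> real CARD('n) * (1 - p)"
  shows "superquantile_objective \<nu> d u q - \<eta> * ((\<Sum>i\<in>UNIV. q $ i) - 1) =
    \<eta> + 1 / N * (\<Sum>i\<in>UNIV. pos_part_objective \<nu> (rescaled CARD('n) p d) (u $ i - \<eta>) (N * q $ i))"
proof -
  have "N > 0" using assms by simp
  then have "1 / N * pos_part_objective \<nu> (rescaled CARD('n) p d) (u $ i - \<eta>) (N * q $ i) =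
      q $ i * u $ i - \<eta> * q $ i - \<nu> * d (q $ i)" for i
    by (simp add: pos_part_objective_def rescaled_def N_def[symmetric] diff_divide_distrib
        left_diff_distrib)
  then have "1 / N * (\<Sum>i\<in>UNIV. pos_part_objective \<nu> (rescaled CARD('n) p d) (u $ i - \<eta>) (N * q $ i)) =
      (\<Sum>i\<in>UNIV. q $ i * u $ i - \<eta> * q $ i - \<nu> * d (q $ i))"
    by (simp only: sum_distrib_left)
  also have "\<dots> = superquantile_objective \<nu> d u q - \<eta> * (\<Sum>i\<in>UNIV. q $ i)"
    by (simp add: superquantile_objective_def separable_def inner_vec_def
        sum_subtractf sum_distrib_left)
  finally show ?thesis by (simp add: right_diff_distrib)
qed

theorem corollary6:
  fixes p \<nu> :: real and d :: "real \<Rightarrow> real"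
  assumes "0 < p" "p < 1" and "0 < \<nu>"
    and "strongly_convex_on {0..1} d"
    and "1 / (real CARD('n::finite) * (1 - p)) \<le> 1"
    and "\<forall>u :: real ^ 'n.
           \<exists>q. is_arg_max (superquantile_objective \<nu> d u) (\<lambda>q. q \<in> risk_envelope p) q"
    and "\<forall>\<eta>. \<exists>t. is_arg_max (pos_part_objective \<nu> (rescaled CARD('n) p d) \<eta>)
                     (\<lambda>t. t \<in> {0..1}) t"
  defines "F \<equiv> \<lambda>(u :: real ^ 'n) \<eta>. \<eta> + 1 / (real CARD('n) * (1 - p)) *
             (\<Sum>i\<in>UNIV. smoothed_pos_part \<nu> (rescaled CARD('n) p d) (u $ i - \<eta>))"
  shows "\<forall>u :: real ^ 'n. \<exists>\<eta>. is_arg_min (F u) (\<lambda>_. True) \<eta> \<and>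
           smoothed_superquantile p \<nu> d u = F u \<eta>"
proof
  fix u :: "real ^ 'n"
  define N where "N = real CARD('n) * (1 - p)"
  have N: "N > 0" using \<open>p < 1\<close> by (simp add: N_def)
  let ?G = "superquantile_objective \<nu> d u"
  let ?h = "\<lambda>\<eta> t. pos_part_objective \<nu> (rescaled CARD('n) p d) \<eta> t"
  let ?m = "smoothed_pos_part \<nu> (rescaled CARD('n) p d)"
  let ?L = "\<lambda>q :: real ^ 'n. \<Sum>i\<in>UNIV. q $ i"
  define B where "B = {q :: real ^ 'n. \<forall>i. q $ i \<in> {0..1 / N}}"
  have F: "F u \<eta> = \<eta> + 1 / N * (\<Sum>i\<in>UNIV. ?m (u $ i - \<eta>))" for \<eta>
    by (simp add: F_def N_def)
  have lagrangian: "?G q - \<eta> * (?L q - 1) = \<eta> + 1 / N * (\<Sum>i\<in>UNIV. ?h (u $ i - \<eta>) (N * q $ i))"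
    for q \<eta>
    unfolding N_def using \<open>p < 1\<close> by (rule superquantile_objective_lagrangian)
  have envelope: "q \<in> risk_envelope p \<longleftrightarrow> q \<in> B \<and> ?L q = 1" for q :: "real ^ 'n"
    by (auto simp: risk_envelope_def B_def N_def)

  obtain q where q: "is_arg_max ?G (\<lambda>q. q \<in> risk_envelope p) q"
    using assms(6) by blast
  have S: "smoothed_superquantile p \<nu> d u = ?G q"
    unfolding smoothed_superquantile_def by (rule SUP_eq_is_arg_max[OF q])
  have qB: "q \<in> B" "?L q = 1"
    using q envelope by (auto simp: is_arg_max_linorder)

  have m_upper: "?h \<eta> t \<le> ?m \<eta>" if "t \<in> {0..1}" for \<eta> t
  proof -
    obtain t' where t': "is_arg_max (?h \<eta>) (\<lambda>t. t \<in> {0..1}) t'" using assms(7) by blast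
    then have "?m \<eta> = ?h \<eta> t'" unfolding smoothed_pos_part_def by (rule SUP_eq_is_arg_max)
    then show ?thesis using t' that by (simp add: is_arg_max_linorder)
  qed
  have weak: "?G q \<le> F u \<eta>" for \<eta>
  proof -
    have "?h (u $ i - \<eta>) (N * q $ i) \<le> ?m (u $ i - \<eta>)" for i
      using qB N by (intro m_upper) (auto simp: B_def field_simps)
    then have "\<eta> + 1 / N * (\<Sum>i\<in>UNIV. ?h (u $ i - \<eta>) (N * q $ i)) \<le> F u \<eta>"
      unfolding F using N by (intro add_left_mono mult_left_mono sum_mono) auto
    then show ?thesis using lagrangian[of q \<eta>] qB by simp
  qed

  have "convex_on {0..1 / N} d"
    using assms(5)
    by (intro convex_on_subset[OF strongly_convex_on_imp_convex_on[OF assms(4)]]) (auto simp: N_def)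
  then have "concave_on B ?G"
    unfolding B_def using \<open>0 < \<nu>\<close> by (intro concave_on_superquantile_objective) auto
  moreover have "linear ?L"
    by (auto intro!: linearI simp: sum.distrib sum_distrib_left)
  moreover have "?G y \<le> ?G q" if "y \<in> B" "?L y = 1" for y
    using q that envelope by (auto simp: is_arg_max_linorder)
  moreover have "0 \<in> B" "?L 0 < 1" using N by (auto simp: B_def)
  moreover have "(\<chi> i. 1 / N) \<in> B" using N by (auto simp: B_def)
  moreover have "1 < ?L (\<chi> i. 1 / N)"
    using \<open>0 < p\<close> \<open>p < 1\<close> by (simp add: N_def field_simps)
  ultimately obtain \<eta> where \<eta>: "\<And>y. y \<in> B \<Longrightarrow> ?G y \<le> ?G q + \<eta> * (?L y - 1)"
    by (rule concave_lagrange_multiplier) auto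

  \<comment> \<open>The relaxed problem splits over the coordinates, so maximisers of the scalar problems
    assemble into a point of the box at which the Lagrangian equals the dual function.\<close>
  have "\<forall>i. \<exists>t. is_arg_max (?h (u $ i - \<eta>)) (\<lambda>t. t \<in> {0..1}) t"
    using assms(7) by blast
  then obtain t where t: "\<And>i. is_arg_max (?h (u $ i - \<eta>)) (\<lambda>t. t \<in> {0..1}) (t i)"
    by (rule choice[THEN exE]) blast
  define y :: "real ^ 'n" where "y = (\<chi> i. t i / N)"
  have "y \<in> B"
    using t N by (auto simp: B_def y_def is_arg_max_linorder divide_right_mono)
  have "?m (u $ i - \<eta>) = ?h (u $ i - \<eta>) (N * y $ i)" for i
    unfolding smoothed_pos_part_def using SUP_eq_is_arg_max[OF t[of i]] N by (simp add: y_def)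
  then have "F u \<eta> = ?G y - \<eta> * (?L y - 1)"
    unfolding F lagrangian by simp
  then have "F u \<eta> = ?G q"
    using \<eta>[OF \<open>y \<in> B\<close>] weak[of \<eta>] by simp
  then show "\<exists>\<eta>. is_arg_min (F u) (\<lambda>_. True) \<eta> \<and> smoothed_superquantile p \<nu> d u = F u \<eta>"
    using S weak by (intro exI[of _ \<eta>]) (auto simp: is_arg_min_linorder)
qed

end
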